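(* Consider spherical quadrilaterals $(v_1v_2v_3v_4)$ on the unit sphere $\mathbb{S}^2$, possibly nonconvex and self-intersecting, satisfying: (i) all edge lengths are less than $\pi$; (ii) no interior angle is singular. Every such quadrilateral is uniquely determined by one edge length and all its interior angles. That is, if $(v_1v_2v_3v_4)$ and $(v_1'v_2'v_3'v_4')$ are two such quadrilaterals whose interior angles at $v_i$ and $v_i'$ are equal for $i=1,2,3,4$, and for which one pair of corresponding edges (e.g. $v_1v_2$ and $v_1'v_2'$) have equal length, then the two quadrilaterals are congruent.
   Context: A spherical quadrilateral $(v_1v_2v_3v_4)$ is a closed path on the oriented unit sphere $\mathbb{S}^2$ made of four consecutive nondegenerate geodesic arcs (edges) $v_1v_2, v_2v_3, v_3v_4, v_4v_1$; it may intersect itself. One side (left or right) of the oriented closed path is fixed, consistently along the path, and the interior angle at a vertex is the angle between the two edges at that vertex measured on this side; it takes values between $0$ and $2\pi$. An angle is singular if it is $0$ or $\pi$ (where $2\pi$ is identified with $0$), so condition (ii) says all interior angles lie in $(0,\pi)\cup(\pi,2\pi)$. Two quadrilaterals are congruent if an isometry of $\mathbb{S}^2$ takes each vertex and edge of one to the corresponding vertex and edge of the other. *)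

theory Defs
  imports "HOL-Analysis.Analysis"
begin

unbundle cross3_syntax

abbreviation S2 :: "(real^3) set" where
  "S2 \<equiv> sphere 0 1"

text \<open>
  A geodesic arc is given by its starting point \<open>p\<close>, its initial unit tangent vector \<open>u\<close>
  and its length \<open>l\<close>; it is the arc \<open>t \<mapsto> cos t p + sin t u\<close>, \<open>0 \<le> t \<le> l\<close>, of a great circle.
  Nondegeneracy is \<open>0 < l\<close>; the bound \<open>l < 2 \<pi>\<close> says that the arc is a proper part of the
  great circle. Arcs of length at least \<open>\<pi>\<close> are not excluded here.
\<close>

record garc =
  start :: "real^3"
  dir :: "real^3"
  len :: real

definition is_garc :: "garc \<Rightarrow> bool" where
  "is_garc A \<longleftrightarrow> start A \<in> S2 \<and> dir A \<in> S2 \<and> start A \<bullet> dir A = 0 \<and> 0 < len A \<and> len A < 2 * pi"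

definition garc_at :: "garc \<Rightarrow> real \<Rightarrow> real^3" where
  "garc_at A t = cos t *\<^sub>R start A + sin t *\<^sub>R dir A"

definition garc_velocity :: "garc \<Rightarrow> real \<Rightarrow> real^3" where
  "garc_velocity A t = - sin t *\<^sub>R start A + cos t *\<^sub>R dir A"

definition garc_set :: "garc \<Rightarrow> (real^3) set" where
  "garc_set A = garc_at A ` {0..len A}"

datatype side = Left_Side | Right_Side

text \<open>
  Indices live in the cyclic type \<open>4\<close>, where \<open>4 = 0\<close>; edge \<open>i\<close> is the arc from
  vertex \<open>i\<close> to vertex \<open>i + 1\<close>. The chosen side of the path is part of the data.
\<close>

record quad =
  edge :: "4 \<Rightarrow> garc"
  qside :: side

definition vertex :: "quad \<Rightarrow> 4 \<Rightarrow> real^3" where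
  "vertex Q i = start (edge Q i)"

definition edge_length :: "quad \<Rightarrow> 4 \<Rightarrow> real" where
  "edge_length Q i = len (edge Q i)"

definition spherical_quadrilateral :: "quad \<Rightarrow> bool" where
  "spherical_quadrilateral Q \<longleftrightarrow>
     (\<forall>i. is_garc (edge Q i) \<and> garc_at (edge Q i) (edge_length Q i) = vertex Q (i + 1))"

text \<open>
  For unit tangent vectors \<open>a\<close>, \<open>b\<close> at a point \<open>p\<close> of the sphere, \<open>p \<times> a\<close> is \<open>a\<close> turned
  counterclockwise (seen from outside) by a right angle, so the following is the \<open>\<theta>\<close> in
  \<open>[0, 2 \<pi>)\<close> with \<open>b = cos \<theta> a + sin \<theta> (p \<times> a)\<close>.
\<close>

definition ccw_angle :: "real^3 \<Rightarrow> real^3 \<Rightarrow> real^3 \<Rightarrow> real" where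
  "ccw_angle p a b = Arg2pi (Complex (a \<bullet> b) ((p \<times> a) \<bullet> b))"

text \<open>
  The side to the left of the path at a vertex is swept out by turning the direction of the
  outgoing edge counterclockwise until it reaches the direction pointing back along the
  incoming edge.
\<close>

definition interior_angle :: "quad \<Rightarrow> 4 \<Rightarrow> real" where
  "interior_angle Q i =
     (let out = dir (edge Q i);
          back = - garc_velocity (edge Q (i - 1)) (edge_length Q (i - 1))
      in case qside Q of
           Left_Side \<Rightarrow> ccw_angle (vertex Q i) out back
         | Right_Side \<Rightarrow> ccw_angle (vertex Q i) back out)"

text \<open>Since \<^const>\<open>ccw_angle\<close> takes values in \<open>[0, 2 \<pi>)\<close>, the value \<open>2 \<pi>\<close> is represented by \<open>0\<close>.\<close>

definition singular_angle :: "real \<Rightarrow> bool" where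
  "singular_angle \<theta> \<longleftrightarrow> \<theta> = 0 \<or> \<theta> = pi"

definition sphere_dist :: "real^3 \<Rightarrow> real^3 \<Rightarrow> real" where
  "sphere_dist x y = arccos (x \<bullet> y)"

definition sphere_isometry :: "(real^3 \<Rightarrow> real^3) \<Rightarrow> bool" where
  "sphere_isometry f \<longleftrightarrow>
     bij_betw f S2 S2 \<and> (\<forall>x\<in>S2. \<forall>y\<in>S2. sphere_dist (f x) (f y) = sphere_dist x y)"

definition congruent_quads :: "quad \<Rightarrow> quad \<Rightarrow> bool" where
  "congruent_quads Q Q' \<longleftrightarrow>
     (\<exists>f. sphere_isometry f \<and>
        (\<forall>i. f (vertex Q i) = vertex Q' i \<and> f ` garc_set (edge Q i) = garc_set (edge Q' i)))"

end

theory Submission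
  imports Defs
begin

text \<open>
  Every edge lies on an oriented great circle, and it is encoded by the pole \<open>w\<^sub>i\<close> of that circle on
  the chosen side of the path. Let \<open>\<theta>\<^sub>i\<close> be the interior angles and \<open>l\<^sub>i\<close> the edge lengths.
  The path can be followed with the orthonormal frame (vertex, direction, pole): going along
  edge \<open>i\<close> turns the vertex by \<open>l\<^sub>i\<close> towards the direction and fixes \<open>w\<^sub>i\<close>, and passing vertex \<open>i\<close> fixes
  that vertex and turns the direction towards the pole by the exterior angle \<open>\<pi> - \<theta>\<^sub>i\<close>.
  Hence \<open>w\<^sub>i\<^sub>-\<^sub>1 \<bullet> w\<^sub>i = - cos \<theta>\<^sub>i\<close>, and two steps give

  \<^item> \<open>w\<^sub>i\<^sub>-\<^sub>1 \<bullet> w\<^sub>i\<^sub>+\<^sub>1 = cos \<theta>\<^sub>i cos \<theta>\<^sub>i\<^sub>+\<^sub>1 - sin \<theta>\<^sub>i sin \<theta>\<^sub>i\<^sub>+\<^sub>1 cos l\<^sub>i\<close>, the law of cosines for angles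
    (\<open>pole_inner_pole2\<close>);
  \<^item> the triple product of \<open>w\<^sub>i\<^sub>-\<^sub>1, w\<^sub>i, w\<^sub>i\<^sub>+\<^sub>1\<close> equals, up to the sign of the side,
    \<open>sin \<theta>\<^sub>i sin \<theta>\<^sub>i\<^sub>+\<^sub>1 sin l\<^sub>i\<close> (\<open>pole_triple\<close>).

  Only four poles occur. So the inner product \<open>w\<^sub>i\<^sub>-\<^sub>1 \<bullet> w\<^sub>i\<^sub>+\<^sub>1 = w\<^sub>i\<^sub>+\<^sub>1 \<bullet> w\<^sub>i\<^sub>+\<^sub>3\<close> is given by the law of
  cosines both at edge \<open>i\<close> and at the opposite edge \<open>i + 2\<close>. Since no sine of an angle vanishes
  and \<open>cos\<close> is injective on \<open>(0, \<pi>)\<close>, the length \<open>l\<^sub>i\<close> and the angles determine \<open>l\<^sub>i\<^sub>+\<^sub>2\<close>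
  (\<open>opposite_length_determined\<close>).

  For the other two edges the product \<open>w\<^sub>i \<bullet> w\<^sub>i\<^sub>+\<^sub>2\<close> is needed. The vectors
  \<open>a = w\<^sub>i\<^sub>-\<^sub>1\<close> and \<open>c = w\<^sub>i\<^sub>+\<^sub>1\<close> are independent, because their triple product with \<open>w\<^sub>i\<close> is nonzero;
  so \<open>w\<^sub>i \<bullet> w\<^sub>i\<^sub>+\<^sub>2\<close> can be computed from the components of \<open>w\<^sub>i\<close> and \<open>w\<^sub>i\<^sub>+\<^sub>2\<close> along \<open>a\<close>, \<open>c\<close> and \<open>a \<times> c\<close>.
  Those along \<open>a\<close> and \<open>c\<close> are cosines of angles, and those along \<open>a \<times> c\<close> are the triple products
  above. Mirroring \<open>w\<^sub>i\<^sub>+\<^sub>2\<close> at the plane of \<open>a\<close> and \<open>c\<close> would give a second solution with the same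
  inner products, but with the opposite sign of \<open>sin l\<^sub>i\<^sub>+\<^sub>2\<close>; it is excluded by \<open>0 < l\<^sub>i\<^sub>+\<^sub>2 < \<pi>\<close>.
  Then the law of cosines yields \<open>l\<^sub>i\<^sub>+\<^sub>1\<close> and \<open>l\<^sub>i\<^sub>+\<^sub>3\<close>
  (\<open>adjacent_length_determined\<close>).

  Finally, when all lengths and angles agree, the orthogonal map taking one frame of the first
  quadrilateral to the corresponding frame of the second one takes each frame to the corresponding
  frame. If the chosen sides differ, this map reverses the orientation.
\<close>

section \<open>Orthonormal frames and angles in tangent planes\<close>

lemma orthonormal_cross_expansion:
  fixes p a x :: "real^3"
  assumes "p \<bullet> p = 1" "a \<bullet> a = 1" "p \<bullet> a = 0"
  shows "x = (x \<bullet> p) *\<^sub>R p + (x \<bullet> a) *\<^sub>R a + (x \<bullet> (p \<times> a)) *\<^sub>R (p \<times> a)"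
proof -
  define n where "n = p \<times> a"
  define d where "d = x - ((x \<bullet> p) *\<^sub>R p + (x \<bullet> a) *\<^sub>R a + (x \<bullet> n) *\<^sub>R n)"
  have nn: "n \<bullet> n = 1" "p \<bullet> n = 0" "a \<bullet> n = 0"
    unfolding n_def using assms by (simp_all add: dot_cross inner_commute dot_cross_self)
  have d: "d \<bullet> p = 0" "d \<bullet> a = 0" "d \<bullet> n = 0"
    unfolding d_def using assms nn
    by (simp_all add: inner_diff_left inner_add_left inner_diff_right inner_add_right inner_commute)
  \<comment> \<open>The remainder is orthogonal to \<open>n\<close>, and parallel to it because it is orthogonal to \<open>p\<close> and \<open>a\<close>.\<close>
  have "d \<times> n = 0"
    unfolding n_def Lagrange using d by (simp add: inner_commute)
  with d(3) nn(1) have "d = 0"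
    using norm_and_cross_eq_0[of d n] by auto
  then show ?thesis unfolding d_def n_def by simp
qed

lemma ccw_angle_cos_sin:
  assumes "p \<bullet> p = 1" "a \<bullet> a = 1" "p \<bullet> a = 0" "b \<bullet> b = 1" "p \<bullet> b = 0"
  shows "cos (ccw_angle p a b) = a \<bullet> b" "sin (ccw_angle p a b) = (p \<times> a) \<bullet> b"
proof -
  define z where "z = Complex (a \<bullet> b) ((p \<times> a) \<bullet> b)"
  have "1 = b \<bullet> ((b \<bullet> p) *\<^sub>R p + (b \<bullet> a) *\<^sub>R a + (b \<bullet> (p \<times> a)) *\<^sub>R (p \<times> a))"
    using orthonormal_cross_expansion[OF assms(1-3), of b] assms(4) by simp
  then have "(a \<bullet> b)\<^sup>2 + ((p \<times> a) \<bullet> b)\<^sup>2 = 1"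
    using assms(5) by (simp add: inner_add_right inner_commute power2_eq_square)
  then have "cmod z = 1" by (simp add: z_def cmod_def)
  then have "z = exp (\<i> * of_real (Arg2pi z))"
    using Arg2pi_eq[of z] by simp
  then have "z = cis (Arg2pi z)" by (simp add: cis_conv_exp)
  then have "Re z = cos (Arg2pi z)" "Im z = sin (Arg2pi z)"
    by (metis cis.sel)+
  then show "cos (ccw_angle p a b) = a \<bullet> b" "sin (ccw_angle p a b) = (p \<times> a) \<bullet> b"
    by (simp_all add: ccw_angle_def z_def)
qed

text \<open>
  With \<open>n = a \<times> c\<close>, this is the Binet-Cauchy identity for \<open>(n \<times> x) \<bullet> (n \<times> y)\<close>, in which
  the vectors \<open>n \<times> x\<close> and \<open>n \<times> y\<close> are combinations of \<open>a\<close> and \<open>c\<close> by Lagrange's identity.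
\<close>

lemma inner_from_components:
  fixes a c x y :: "real^3"
  assumes "a \<bullet> a = 1" "c \<bullet> c = 1"
  shows "(1 - (a \<bullet> c)\<^sup>2) * (x \<bullet> y) =
    ((a \<times> c) \<bullet> x) * ((a \<times> c) \<bullet> y) + (a \<bullet> x) * (a \<bullet> y) + (c \<bullet> x) * (c \<bullet> y)
      - (a \<bullet> c) * ((a \<bullet> x) * (c \<bullet> y) + (c \<bullet> x) * (a \<bullet> y))"
proof -
  define n where "n = a \<times> c"
  have nn: "n \<bullet> n = 1 - (a \<bullet> c)\<^sup>2"
    unfolding n_def using assms by (simp add: dot_cross inner_commute power2_eq_square)
  have nx: "n \<times> z = (a \<bullet> z) *\<^sub>R c - (c \<bullet> z) *\<^sub>R a" for z
    using Lagrange[of z a c] cross_skew[of n z]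
    by (simp add: n_def inner_commute)
  have "(n \<bullet> n) * (x \<bullet> y) - (n \<bullet> y) * (x \<bullet> n) = (n \<times> x) \<bullet> (n \<times> y)"
    by (simp add: dot_cross)
  also have "\<dots> = (a \<bullet> x) * (a \<bullet> y) + (c \<bullet> x) * (c \<bullet> y)
      - (a \<bullet> c) * ((a \<bullet> x) * (c \<bullet> y) + (c \<bullet> x) * (a \<bullet> y))"
    unfolding nx using assms by (simp add: inner_diff_left inner_diff_right inner_commute algebra_simps)
  finally show ?thesis unfolding nn unfolding n_def[symmetric] by (simp add: inner_commute algebra_simps)
qed

section \<open>Poles of the edges and the moving frame\<close>

definition side_sign :: "quad \<Rightarrow> real" where
  "side_sign Q = (case qside Q of Left_Side \<Rightarrow> 1 | Right_Side \<Rightarrow> -1)"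

definition pole :: "quad \<Rightarrow> 4 \<Rightarrow> real^3" where
  "pole Q i = side_sign Q *\<^sub>R (vertex Q i \<times> dir (edge Q i))"

definition end_velocity :: "quad \<Rightarrow> 4 \<Rightarrow> real^3" where
  "end_velocity Q i = garc_velocity (edge Q i) (edge_length Q i)"

lemma side_sign_square [simp]: "side_sign Q * side_sign Q = 1"
  by (simp add: side_sign_def split: side.split)

lemma frame_orthonormal:
  assumes "spherical_quadrilateral Q"
  shows "vertex Q i \<bullet> vertex Q i = 1" "dir (edge Q i) \<bullet> dir (edge Q i) = 1"
    "pole Q i \<bullet> pole Q i = 1" "vertex Q i \<bullet> dir (edge Q i) = 0"
    "vertex Q i \<bullet> pole Q i = 0" "dir (edge Q i) \<bullet> pole Q i = 0"
proof -
  have "is_garc (edge Q i)" using assms by (simp add: spherical_quadrilateral_def)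
  then have "vertex Q i \<bullet> vertex Q i = 1 \<and> dir (edge Q i) \<bullet> dir (edge Q i) = 1
    \<and> vertex Q i \<bullet> dir (edge Q i) = 0"
    by (simp add: is_garc_def vertex_def dot_square_norm)
  then show "vertex Q i \<bullet> vertex Q i = 1" "dir (edge Q i) \<bullet> dir (edge Q i) = 1"
    "pole Q i \<bullet> pole Q i = 1" "vertex Q i \<bullet> dir (edge Q i) = 0"
    "vertex Q i \<bullet> pole Q i = 0" "dir (edge Q i) \<bullet> pole Q i = 0"
    by (simp_all add: pole_def dot_cross inner_commute dot_cross_self)
qed

lemma vertex_step:
  assumes "spherical_quadrilateral Q"
  shows "vertex Q (i + 1) =
    cos (edge_length Q i) *\<^sub>R vertex Q i + sin (edge_length Q i) *\<^sub>R dir (edge Q i)"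
  using assms unfolding spherical_quadrilateral_def garc_at_def vertex_def by metis

lemma end_velocity_eq:
  "end_velocity Q i =
    - sin (edge_length Q i) *\<^sub>R vertex Q i + cos (edge_length Q i) *\<^sub>R dir (edge Q i)"
  by (simp add: end_velocity_def garc_velocity_def vertex_def)

lemma end_velocity_tangent:
  assumes "spherical_quadrilateral Q"
  shows "end_velocity Q i \<bullet> end_velocity Q i = 1" "vertex Q (i + 1) \<bullet> end_velocity Q i = 0"
  unfolding vertex_step[OF assms] end_velocity_eq
  using frame_orthonormal[OF assms, of i] sin_cos_squared_add[of "edge_length Q i"]
  by (simp_all add: inner_diff_left inner_diff_right inner_add_left inner_add_right inner_commute
      power2_eq_square)

text \<open>
  An edge has the same pole at both ends; this form of it lets the turn at the final vertex
  be applied to the velocity with which the edge arrives there.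
\<close>

lemma pole_at_end:
  assumes "spherical_quadrilateral Q"
  shows "pole Q i = side_sign Q *\<^sub>R (vertex Q (i + 1) \<times> end_velocity Q i)"
proof -
  let ?l = "edge_length Q i" and ?p = "vertex Q i" and ?u = "dir (edge Q i)"
  have "vertex Q (i + 1) \<times> end_velocity Q i =
      (cos ?l * cos ?l) *\<^sub>R (?p \<times> ?u) + (sin ?l * sin ?l) *\<^sub>R (?p \<times> ?u)"
    unfolding vertex_step[OF assms] end_velocity_eq
    using cross_skew[of ?u ?p]
    by (simp add: cross_add_left cross_add_right cross_mult_left cross_mult_right
        Cross3.right_diff_distrib)
  also have "\<dots> = (cos ?l * cos ?l + sin ?l * sin ?l) *\<^sub>R (?p \<times> ?u)"
    by (simp only: scaleR_left_distrib)
  finally show ?thesis by (simp add: pole_def)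
qed

text \<open>
  Using the pole on the chosen side instead of the left one absorbs the case distinction between
  the two sides: exchanging the arguments of the oriented angle reverses the sign of its sine.
\<close>

lemma end_velocity_turn:
  assumes "spherical_quadrilateral Q"
  shows "end_velocity Q i = - cos (interior_angle Q (i + 1)) *\<^sub>R dir (edge Q (i + 1))
    - sin (interior_angle Q (i + 1)) *\<^sub>R pole Q (i + 1)"
proof -
  let ?p = "vertex Q (i + 1)" and ?u = "dir (edge Q (i + 1))" and ?b = "- end_velocity Q i"
  let ?t = "interior_angle Q (i + 1)"
  note on = frame_orthonormal[OF assms, of "i + 1"]
  have b: "?b \<bullet> ?b = 1" "?p \<bullet> ?b = 0"
    using end_velocity_tangent[OF assms, of i] by simp_all
  have bp: "?b \<bullet> ?p = 0" using b(2) by (simp only: inner_commute)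
  have skew: "(?p \<times> ?b) \<bullet> ?u = - ((?p \<times> ?u) \<bullet> ?b)"
    unfolding cross_triple[of ?p ?b ?u] cross_triple[of ?p ?u ?b]
    by (subst cross_skew) (rule inner_minus_left)
  have "cos ?t = ?b \<bullet> ?u \<and> sin ?t = side_sign Q * (?b \<bullet> (?p \<times> ?u))"
  proof (cases "qside Q")
    case Left_Side
    then have "?t = ccw_angle ?p ?u ?b"
      by (simp add: interior_angle_def end_velocity_def)
    with Left_Side show ?thesis
      using ccw_angle_cos_sin[OF on(1,2,4) b] by (simp add: side_sign_def inner_commute)
  next
    case Right_Side
    then have "?t = ccw_angle ?p ?b ?u"
      by (simp add: interior_angle_def end_velocity_def)
    with Right_Side show ?thesis
      using ccw_angle_cos_sin[OF on(1) b on(2,4)] skew by (simp add: side_sign_def inner_commute)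
  qed
  moreover have "?b = (?b \<bullet> ?u) *\<^sub>R ?u + (?b \<bullet> (?p \<times> ?u)) *\<^sub>R (?p \<times> ?u)"
    by (rule orthonormal_cross_expansion[OF on(1,2,4), of ?b, unfolded bp scaleR_zero_left add_0_left])
  moreover have "(?b \<bullet> (?p \<times> ?u)) *\<^sub>R (?p \<times> ?u)
      = (side_sign Q * (?b \<bullet> (?p \<times> ?u))) *\<^sub>R pole Q (i + 1)"
    by (simp add: pole_def mult.left_commute mult.assoc[symmetric])
  ultimately have "?b = cos ?t *\<^sub>R ?u + sin ?t *\<^sub>R pole Q (i + 1)" by metis
  then have "- ?b = - (cos ?t *\<^sub>R ?u + sin ?t *\<^sub>R pole Q (i + 1))" by (rule arg_cong)
  then show ?thesis by simp
qed

lemma pole_turn: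
  assumes "spherical_quadrilateral Q"
  shows "pole Q i = sin (interior_angle Q (i + 1)) *\<^sub>R dir (edge Q (i + 1))
    - cos (interior_angle Q (i + 1)) *\<^sub>R pole Q (i + 1)"
proof -
  let ?p = "vertex Q (i + 1)" and ?u = "dir (edge Q (i + 1))" and ?t = "interior_angle Q (i + 1)"
  have w: "?p \<times> pole Q (i + 1) = - side_sign Q *\<^sub>R ?u"
    using frame_orthonormal[OF assms, of "i + 1"]
    by (simp add: pole_def cross_mult_right Lagrange)
  have "side_sign Q *\<^sub>R (?p \<times> (- cos ?t *\<^sub>R ?u - sin ?t *\<^sub>R pole Q (i + 1))) =
      - cos ?t *\<^sub>R (side_sign Q *\<^sub>R (?p \<times> ?u))
      - sin ?t *\<^sub>R (side_sign Q *\<^sub>R (?p \<times> pole Q (i + 1)))"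
    by (simp add: Cross3.right_diff_distrib cross_mult_right real_vector.scale_right_diff_distrib
        mult.commute)
  also have "\<dots> = sin ?t *\<^sub>R ?u - cos ?t *\<^sub>R pole Q (i + 1)"
    unfolding w by (simp add: pole_def)
  finally show ?thesis
    unfolding pole_at_end[OF assms, of i] end_velocity_turn[OF assms, of i] .
qed

lemma frame_step:
  assumes "spherical_quadrilateral Q"
  defines "t \<equiv> \<lambda>i. interior_angle Q i"
  shows "dir (edge Q (i + 1)) = sin (t (i + 1)) *\<^sub>R pole Q i - cos (t (i + 1)) *\<^sub>R end_velocity Q i"
    and "pole Q (i + 1) = - sin (t (i + 1)) *\<^sub>R end_velocity Q i - cos (t (i + 1)) *\<^sub>R pole Q i"
proof -
  let ?u = "dir (edge Q (i + 1))" and ?w = "pole Q (i + 1)"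
  let ?c = "cos (t (i + 1))" and ?s = "sin (t (i + 1))"
  have one: "x = (?c * ?c) *\<^sub>R x + (?s * ?s) *\<^sub>R x" for x :: "real^3"
    by (simp only: scaleR_left_distrib[symmetric] sin_cos_squared_add3 scaleR_one)
  show "?u = ?s *\<^sub>R pole Q i - ?c *\<^sub>R end_velocity Q i"
    unfolding pole_turn[OF assms(1), of i] end_velocity_turn[OF assms(1), of i]
    by (subst one) (simp add: t_def algebra_simps)
  show "?w = - ?s *\<^sub>R end_velocity Q i - ?c *\<^sub>R pole Q i"
    unfolding pole_turn[OF assms(1), of i] end_velocity_turn[OF assms(1), of i]
    by (subst one) (simp add: t_def algebra_simps)
qed

section \<open>Relations between the poles\<close>

lemma pole_inner_next:
  assumes "spherical_quadrilateral Q"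
  shows "pole Q i \<bullet> pole Q (i + 1) = - cos (interior_angle Q (i + 1))"
  unfolding pole_turn[OF assms, of i] using frame_orthonormal[OF assms, of "i + 1"]
  by (simp add: inner_diff_left)

text \<open>
  Both neighbours of \<open>pole Q i\<close> are expressed in the frame at vertex \<open>i\<close>: the preceding pole by the
  turn at vertex \<open>i\<close>, the following one by transport along edge \<open>i\<close> and the turn at its end.
\<close>

lemma pole_inner_pole2:
  assumes "spherical_quadrilateral Q"
  defines "t \<equiv> \<lambda>i. interior_angle Q i"
  shows "pole Q (i - 1) \<bullet> pole Q (i + 1) =
    cos (t i) * cos (t (i + 1)) - sin (t i) * sin (t (i + 1)) * cos (edge_length Q i)"
proof -
  have prev: "pole Q (i - 1) = sin (t i) *\<^sub>R dir (edge Q i) - cos (t i) *\<^sub>R pole Q i"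
    using pole_turn[OF assms(1), of "i - 1"] by (simp add: t_def)
  show ?thesis
    unfolding prev frame_step(2)[OF assms(1), of i] end_velocity_eq
    using frame_orthonormal[OF assms(1), of i]
    by (simp add: t_def inner_diff_left inner_diff_right inner_add_left inner_add_right
        inner_commute algebra_simps)
qed

lemma pole_triple:
  assumes "spherical_quadrilateral Q"
  defines "t \<equiv> \<lambda>i. interior_angle Q i"
  shows "(pole Q (i - 1) \<times> pole Q (i + 1)) \<bullet> pole Q i =
    - side_sign Q * sin (t i) * sin (t (i + 1)) * sin (edge_length Q i)"
proof -
  let ?p = "vertex Q i" and ?u = "dir (edge Q i)" and ?w = "pole Q i"
  have prev: "pole Q (i - 1) = sin (t i) *\<^sub>R ?u - cos (t i) *\<^sub>R ?w"
    using pole_turn[OF assms(1), of "i - 1"] by (simp add: t_def)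
  have up: "(?u \<times> ?p) \<bullet> ?w = - side_sign Q"
  proof -
    have "?u \<times> ?p = - (?p \<times> ?u)" by (rule cross_skew)
    moreover have "(?p \<times> ?u) \<bullet> (?p \<times> ?u) = 1"
      using frame_orthonormal[OF assms(1), of i] by (simp add: dot_cross inner_commute)
    ultimately show ?thesis by (simp add: pole_def)
  qed
  have z: "(?w \<times> x) \<bullet> ?w = 0" "(x \<times> ?w) \<bullet> ?w = 0" for x
    by (simp_all add: dot_cross_self)
  show ?thesis
    unfolding prev frame_step(2)[OF assms(1), of i] end_velocity_eq
    by (simp add: t_def up z Cross3.left_diff_distrib Cross3.right_diff_distrib cross_add_right
        cross_mult_left cross_mult_right cross_minus_right inner_diff_left inner_add_left algebra_simps)
qed

section \<open>One length and the angles determine all lengths\<close>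

lemma cyclic4_index:
  fixes i :: 4
  shows "i - 1 = i + 3" "i + 1 - 1 = i" "i + 2 - 1 = i + 1"
    "i + 1 + 1 = i + 2" "i + 2 + 1 = i + 3" "i + 3 + 1 = i"
  by (simp_all add: diff_eq_eq add.assoc)

lemma sin_interior_angle_nonzero:
  assumes "\<not> singular_angle (interior_angle Q i)"
  shows "sin (interior_angle Q i) \<noteq> 0"
proof
  let ?t = "interior_angle Q i"
  assume "sin ?t = 0"
  moreover have "0 \<le> ?t" "?t < 2 * pi"
    by (auto simp: interior_angle_def ccw_angle_def Let_def Arg2pi_ge_0 Arg2pi_lt_2pi split: side.split)
  ultimately show False
    using assms sin_eq_0_pi[of "?t - pi"] by (auto simp: singular_angle_def)
qed

lemma edge_length_pos:
  assumes "spherical_quadrilateral Q"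
  shows "0 < edge_length Q i"
  using assms by (auto simp: spherical_quadrilateral_def is_garc_def edge_length_def)

lemma length_determined_by_poles:
  assumes "spherical_quadrilateral Q" "spherical_quadrilateral Q'"
    and "edge_length Q i < pi" "edge_length Q' i < pi"
    and "\<And>j. \<not> singular_angle (interior_angle Q j)"
    and ang: "\<And>j. interior_angle Q j = interior_angle Q' j"
    and poles: "pole Q (i - 1) \<bullet> pole Q (i + 1) = pole Q' (i - 1) \<bullet> pole Q' (i + 1)"
  shows "edge_length Q i = edge_length Q' i"
proof -
  let ?s = "sin (interior_angle Q' i) * sin (interior_angle Q' (i + 1))"
  have "?s \<noteq> 0"
    using sin_interior_angle_nonzero[OF assms(5), of i] sin_interior_angle_nonzero[OF assms(5), of "i + 1"]
    unfolding ang by simp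
  moreover have "?s * cos (edge_length Q i) = ?s * cos (edge_length Q' i)"
    using poles unfolding pole_inner_pole2[OF assms(1)] pole_inner_pole2[OF assms(2)] ang by linarith
  ultimately have "cos (edge_length Q i) = cos (edge_length Q' i)"
    by (simp only: mult_cancel_left simp_thms)
  then show ?thesis
    using assms(3,4) edge_length_pos[OF assms(1), of i] edge_length_pos[OF assms(2), of i]
    by - (rule cos_inj_pi, simp_all)
qed

lemma opposite_length_determined:
  assumes "spherical_quadrilateral Q" "spherical_quadrilateral Q'"
    and "edge_length Q (i + 2) < pi" "edge_length Q' (i + 2) < pi"
    and "\<And>j. \<not> singular_angle (interior_angle Q j)"
    and ang: "\<And>j. interior_angle Q j = interior_angle Q' j"
    and len: "edge_length Q i = edge_length Q' i"
  shows "edge_length Q (i + 2) = edge_length Q' (i + 2)"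
proof (rule length_determined_by_poles[OF assms(1-6)])
  note idx = cyclic4_index[of i]
  have "pole Q (i + 3) \<bullet> pole Q (i + 1) = pole Q' (i + 3) \<bullet> pole Q' (i + 1)"
    using pole_inner_pole2[OF assms(1), of i] pole_inner_pole2[OF assms(2), of i]
    by (simp only: idx ang len)
  then show "pole Q (i + 2 - 1) \<bullet> pole Q (i + 2 + 1) = pole Q' (i + 2 - 1) \<bullet> pole Q' (i + 2 + 1)"
    by (simp only: idx inner_commute)
qed

text \<open>
  The component formula is applied to the poles \<open>i\<close> and \<open>i + 2\<close>, with respect to the two remaining
  poles. The chosen side does not enter the result: both triple products carry its sign, which
  cancels in their product.
\<close>

lemma pole_inner_opposite:
  assumes "spherical_quadrilateral Q"
  defines "t \<equiv> \<lambda>i. interior_angle Q i" and "l \<equiv> \<lambda>i. edge_length Q i"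
  defines "g \<equiv> \<lambda>i. pole Q (i - 1) \<bullet> pole Q (i + 1)"
  shows "(1 - (g i)\<^sup>2) * g (i + 1) =
    - sin (t i) * sin (t (i + 1)) * sin (t (i + 2)) * sin (t (i + 3)) * sin (l i) * sin (l (i + 2))
    + cos (t i) * cos (t (i + 3)) + cos (t (i + 1)) * cos (t (i + 2))
    - g i * (cos (t i) * cos (t (i + 2)) + cos (t (i + 1)) * cos (t (i + 3)))"
proof -
  let ?a = "pole Q (i - 1)" and ?c = "pole Q (i + 1)" and ?x = "pole Q i" and ?y = "pole Q (i + 2)"
  note idx = cyclic4_index[of i]
  have x: "(?a \<times> ?c) \<bullet> ?x = - side_sign Q * sin (t i) * sin (t (i + 1)) * sin (l i)"
    using pole_triple[OF assms(1), of i] by (simp add: t_def l_def)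
  have "(?c \<times> ?a) \<bullet> ?y = - side_sign Q * sin (t (i + 2)) * sin (t (i + 3)) * sin (l (i + 2))"
    using pole_triple[OF assms(1), of "i + 2"] by (simp add: t_def l_def idx)
  then have y: "(?a \<times> ?c) \<bullet> ?y = side_sign Q * sin (t (i + 2)) * sin (t (i + 3)) * sin (l (i + 2))"
    using cross_skew[of ?a ?c] by simp
  have "((?a \<times> ?c) \<bullet> ?x) * ((?a \<times> ?c) \<bullet> ?y) = - (side_sign Q * side_sign Q) *
    (sin (t i) * sin (t (i + 1)) * sin (t (i + 2)) * sin (t (i + 3)) * sin (l i) * sin (l (i + 2)))"
    unfolding x y by (simp only: mult_ac minus_mult_left minus_mult_right)
  then have xy: "((?a \<times> ?c) \<bullet> ?x) * ((?a \<times> ?c) \<bullet> ?y) =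
    - (sin (t i) * sin (t (i + 1)) * sin (t (i + 2)) * sin (t (i + 3)) * sin (l i) * sin (l (i + 2)))"
    by simp
  have dots: "?a \<bullet> ?x = - cos (t i)" "?x \<bullet> ?c = - cos (t (i + 1))"
    "?c \<bullet> ?y = - cos (t (i + 2))" "?y \<bullet> ?a = - cos (t (i + 3))"
    using pole_inner_next[OF assms(1), of "i - 1"] pole_inner_next[OF assms(1), of i]
      pole_inner_next[OF assms(1), of "i + 1"] pole_inner_next[OF assms(1), of "i + 2"]
    by (simp_all add: t_def idx)
  have "(1 - (?a \<bullet> ?c)\<^sup>2) * (?x \<bullet> ?y) =
    - (sin (t i) * sin (t (i + 1)) * sin (t (i + 2)) * sin (t (i + 3)) * sin (l i) * sin (l (i + 2)))
    + cos (t i) * cos (t (i + 3)) + cos (t (i + 1)) * cos (t (i + 2))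
    - (?a \<bullet> ?c) * (cos (t i) * cos (t (i + 2)) + cos (t (i + 1)) * cos (t (i + 3)))"
    using inner_from_components[OF frame_orthonormal(3)[OF assms(1)] frame_orthonormal(3)[OF assms(1)],
        of "i - 1" "i + 1" ?x ?y] dots
    by (simp add: xy inner_commute[of ?a ?y] inner_commute[of ?c ?x])
  then show ?thesis unfolding g_def by (simp only: idx mult_minus_left)
qed

text \<open>
  If the neighbouring poles were parallel, edge \<open>i\<close> would join two points of one great circle carrying
  both neighbouring edges; being shorter than \<open>\<pi>\<close>, it would lie on that circle and its end
  angles would be singular. The triple product expresses this algebraically.
\<close>

lemma poles_independent:
  assumes "spherical_quadrilateral Q" "edge_length Q i < pi"
    and "\<And>j. \<not> singular_angle (interior_angle Q j)"
  shows "(pole Q (i - 1) \<bullet> pole Q (i + 1))\<^sup>2 \<noteq> 1"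
proof
  let ?a = "pole Q (i - 1)" and ?c = "pole Q (i + 1)"
  assume "(?a \<bullet> ?c)\<^sup>2 = 1"
  then have "(?a \<times> ?c) \<bullet> (?a \<times> ?c) = 0"
    using frame_orthonormal(3)[OF assms(1)] by (simp add: dot_cross inner_commute power2_eq_square)
  then have "(?a \<times> ?c) \<bullet> pole Q i = 0" by simp
  moreover have "sin (edge_length Q i) > 0"
    using assms(2) edge_length_pos[OF assms(1)] by (simp add: sin_gt_zero)
  moreover have "side_sign Q \<noteq> 0" by (simp add: side_sign_def split: side.split)
  ultimately show False
    using pole_triple[OF assms(1), of i] sin_interior_angle_nonzero[OF assms(3)] by simp
qed

lemma adjacent_length_determined:
  assumes "spherical_quadrilateral Q" "spherical_quadrilateral Q'"
    and short: "\<And>j. edge_length Q j < pi" "\<And>j. edge_length Q' j < pi"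
    and nonsing: "\<And>j. \<not> singular_angle (interior_angle Q j)"
    and ang: "\<And>j. interior_angle Q j = interior_angle Q' j"
    and len: "edge_length Q i = edge_length Q' i"
  shows "edge_length Q (i + 1) = edge_length Q' (i + 1)"
proof (rule length_determined_by_poles[OF assms(1,2) short nonsing ang])
  have opp: "edge_length Q (i + 2) = edge_length Q' (i + 2)"
    by (rule opposite_length_determined[OF assms(1,2) short nonsing ang len])
  have g: "pole Q (i - 1) \<bullet> pole Q (i + 1) = pole Q' (i - 1) \<bullet> pole Q' (i + 1)"
    using pole_inner_pole2[OF assms(1), of i] pole_inner_pole2[OF assms(2), of i]
    by (simp add: ang len)
  then have "(1 - (pole Q (i - 1) \<bullet> pole Q (i + 1))\<^sup>2) * (pole Q (i + 1 - 1) \<bullet> pole Q (i + 1 + 1)) =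
    (1 - (pole Q (i - 1) \<bullet> pole Q (i + 1))\<^sup>2) * (pole Q' (i + 1 - 1) \<bullet> pole Q' (i + 1 + 1))"
    using pole_inner_opposite[OF assms(1), of i] pole_inner_opposite[OF assms(2), of i]
    by (simp only: ang len opp)
  moreover have "1 - (pole Q (i - 1) \<bullet> pole Q (i + 1))\<^sup>2 \<noteq> 0"
    using poles_independent[OF assms(1) short(1) nonsing, of i] by simp
  ultimately show "pole Q (i + 1 - 1) \<bullet> pole Q (i + 1 + 1) = pole Q' (i + 1 - 1) \<bullet> pole Q' (i + 1 + 1)"
    by (simp only: mult_cancel_left simp_thms)
qed

section \<open>Lengths and angles determine the quadrilateral up to an isometry\<close>

lemma induct_cyclic4:
  fixes i :: 4
  assumes "P k" "\<And>j. P j \<Longrightarrow> P (j + 1)"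
  shows "P i"
proof -
  have "P (k + 1)" by (rule assms(2)) (rule assms(1))
  then have "P (k + 1 + 1)" by (rule assms(2))
  then have "P (k + 2)" by (simp add: add.assoc)
  then have "P (k + 2 + 1)" by (rule assms(2))
  then have "P (k + 3)" by (simp add: add.assoc)
  moreover have "(4::4) = 0" by simp
  then consider "i - k = 1" | "i - k = 2" | "i - k = 3" | "i - k = 0"
    using exhaust_4[of "i - k"] unfolding \<open>(4::4) = 0\<close> by blast
  then have "i \<in> {k, k + 1, k + 2, k + 3}"
    by cases (auto simp: diff_eq_eq add.commute)
  ultimately show ?thesis using assms(1) \<open>P (k + 1)\<close> \<open>P (k + 2)\<close> by auto
qed

lemma orthogonal_transformation_sphere_isometry:
  assumes "orthogonal_transformation f"
  shows "sphere_isometry f"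
proof -
  have inv: "orthogonal_transformation (inv f)" and surj: "surj f"
    using assms by (simp_all add: orthogonal_transformation_inv orthogonal_transformation_surj)
  have "y \<in> f ` S2" if "y \<in> S2" for y
    by (rule image_eqI[of _ _ "inv f y"])
      (use that surj orthogonal_transformation_norm[OF inv, of y] in \<open>auto simp: surj_f_inv_f\<close>)
  then have "f ` S2 = S2"
    using orthogonal_transformation_norm[OF assms] by auto
  then have "bij_betw f S2 S2"
    using orthogonal_transformation_inj[OF assms] by (auto simp: bij_betw_def intro: inj_on_subset)
  then show ?thesis
    using assms by (simp add: sphere_isometry_def sphere_dist_def orthogonal_transformation_def)
qed

lemma frame_transfer:
  assumes "spherical_quadrilateral Q" "spherical_quadrilateral Q'"
  obtains f where "orthogonal_transformation f" "f (vertex Q i) = vertex Q' i"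
    "f (dir (edge Q i)) = dir (edge Q' i)" "f (pole Q i) = pole Q' i"
proof -
  note on = frame_orthonormal[OF assms(1), of i] and on' = frame_orthonormal[OF assms(2), of i]
  define f where "f x = (x \<bullet> vertex Q i) *\<^sub>R vertex Q' i + (x \<bullet> dir (edge Q i)) *\<^sub>R dir (edge Q' i)
    + (x \<bullet> pole Q i) *\<^sub>R pole Q' i" for x
  have lin: "linear f"
    by (intro linearI) (simp_all add: f_def inner_add_left algebra_simps)
  \<comment> \<open>The poles enter quadratically, so the map is orthogonal whichever sides are chosen.\<close>
  have pole: "(x \<bullet> pole Q i) * (y \<bullet> pole Q i) =
    (x \<bullet> (vertex Q i \<times> dir (edge Q i))) * (y \<bullet> (vertex Q i \<times> dir (edge Q i)))" for x y
    by (simp add: pole_def mult_ac)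
  have "f x \<bullet> f y = x \<bullet> y" for x y
  proof -
    have "f x \<bullet> f y = (x \<bullet> vertex Q i) * (y \<bullet> vertex Q i)
      + (x \<bullet> dir (edge Q i)) * (y \<bullet> dir (edge Q i)) + (x \<bullet> pole Q i) * (y \<bullet> pole Q i)"
      using on' by (simp add: f_def inner_add_left inner_add_right inner_commute)
    also have "\<dots> = x \<bullet> y"
      unfolding pole
      using arg_cong[OF orthonormal_cross_expansion[OF on(1,2,4), of y], of "\<lambda>z. x \<bullet> z"]
      by (simp add: inner_add_right inner_commute mult.commute)
    finally show ?thesis .
  qed
  with lin have "orthogonal_transformation f" by (simp add: orthogonal_transformation_def)
  then show thesis
    by (rule that) (use on in \<open>simp_all add: f_def inner_commute\<close>)
qed

text \<open>
  The step from one frame to the next is linear in the frame, with coefficients depending only on a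
  length and an angle, so a linear map matching the frames at vertex \<open>0\<close> matches them all.
\<close>

lemma congruent_if_lengths_and_angles_agree:
  assumes "spherical_quadrilateral Q" "spherical_quadrilateral Q'"
    and len: "\<And>i. edge_length Q i = edge_length Q' i"
    and ang: "\<And>i. interior_angle Q i = interior_angle Q' i"
  shows "congruent_quads Q Q'"
proof -
  obtain f where f: "orthogonal_transformation f" and f0: "f (vertex Q 0) = vertex Q' 0"
    "f (dir (edge Q 0)) = dir (edge Q' 0)" "f (pole Q 0) = pole Q' 0"
    by (rule frame_transfer[OF assms(1,2)])
  interpret linear f by (rule orthogonal_transformation_linear[OF f])
  have frames: "f (vertex Q i) = vertex Q' i \<and> f (dir (edge Q i)) = dir (edge Q' i)
    \<and> f (pole Q i) = pole Q' i" for i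
  proof (induction rule: induct_cyclic4[where k = 0])
    case 1
    show ?case using f0 by simp
  next
    case (2 j)
    then have "f (end_velocity Q j) = end_velocity Q' j"
      by (simp add: end_velocity_eq add diff scale neg len)
    with 2 show ?case
      by (simp add: vertex_step[OF assms(1), of j] vertex_step[OF assms(2), of j]
          frame_step[OF assms(1), of j] frame_step[OF assms(2), of j] add diff scale neg len ang)
  qed
  have "f (garc_at (edge Q i) s) = garc_at (edge Q' i) s" for i s
    using frames[of i] by (simp add: garc_at_def vertex_def add scale)
  then have "f ` garc_set (edge Q i) = garc_set (edge Q' i)" for i
    using len[of i] by (simp add: garc_set_def edge_length_def image_image)
  then show ?thesis
    unfolding congruent_quads_def
    using frames orthogonal_transformation_sphere_isometry[OF f] by blast
qed

theorem theorem5p8: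
  fixes Q Q' :: quad and k :: 4
  assumes "spherical_quadrilateral Q" and "spherical_quadrilateral Q'"
    and "\<And>i. edge_length Q i < pi" and "\<And>i. edge_length Q' i < pi"
    and "\<And>i. \<not> singular_angle (interior_angle Q i)"
    and "\<And>i. \<not> singular_angle (interior_angle Q' i)"
    and "\<And>i. interior_angle Q i = interior_angle Q' i"
    and "edge_length Q k = edge_length Q' k"
  shows "congruent_quads Q Q'"
proof (rule congruent_if_lengths_and_angles_agree[OF assms(1,2) _ assms(7)])
  show "edge_length Q i = edge_length Q' i" for i
  proof (rule induct_cyclic4[where k = k and P = "\<lambda>j. edge_length Q j = edge_length Q' j"])
    show "edge_length Q k = edge_length Q' k" by (rule assms(8))
  next
    fix j
    assume "edge_length Q j = edge_length Q' j"
    then show "edge_length Q (j + 1) = edge_length Q' (j + 1)"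
      by (rule adjacent_length_determined[OF assms(1-5,7)])
  qed
qed

end
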